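(* Let $\beta_4 \in S_n$ be a $4$-cycle. Then \begin{enumerate} \item $c(0, \beta_4) = 4(n-4)!$ for $n \geq 4$; \item $c(3, \beta_4) = (4n-12)\cdot 4(n-4)!$ for $n \geq 4$; \item $c(4, \beta_4) = \left(1+8(n-4)\right)\cdot 4(n-4)!$ for $n \geq 4$; \item $c(5, \beta_4) = \left(12(n-4)+8\binom{n-4}{2}\right)\cdot 4(n-4)!$ for $n \geq 5$; \item $c(6, \beta_4)=\left(14n^2-126n+280\right)\cdot 4(n-4)!$ for $n \geq 6$; \item $c(7, \beta_4)= 24\binom{n-4}{3}\cdot 4(n-4)!$ for $n\geq 7$; \item $c(8, \beta_4) = 6 \binom{n-4}{4}\cdot 4(n-4)!$ for $n \geq 8$; \item $c(k, \beta_4)=0$ for every integer $k$ with $9 \leq k \leq n$. \end{enumerate}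
   Context: $S_n$ is the group of permutations of $[n]=\{1,\dots,n\}$; products are composed right to left. The Hamming distance between $\sigma,\tau\in S_n$ is $H(\sigma,\tau)=|\{a\in[n]:\sigma(a)\neq\tau(a)\}|$. Two permutations $\alpha,\beta\in S_n$ $k$-commute if $H(\alpha\beta,\beta\alpha)=k$. For $\beta\in S_n$ and a nonnegative integer $k$, $c(k,\beta)$ denotes the number of $\alpha\in S_n$ that $k$-commute with $\beta$. A $4$-cycle in $S_n$ is a permutation whose disjoint cycle factorization consists of one cycle of length $4$ and $n-4$ fixed points. *)

theory Defs
  imports "HOL-Combinatorics.Cycles"
begin

text \<open>
  The symmetric group on \<open>[n] = {1..n}\<close>, as functions on all natural numbers that fix
  everything outside \<open>{1..n}\<close>; the product is \<open>(\<circ>)\<close>, which composes right to left.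
\<close>
definition perms :: "nat \<Rightarrow> (nat \<Rightarrow> nat) set" where
  "perms n = {\<sigma>. \<sigma> permutes {1..n}}"

definition hamming :: "nat \<Rightarrow> (nat \<Rightarrow> nat) \<Rightarrow> (nat \<Rightarrow> nat) \<Rightarrow> nat" where
  "hamming n \<sigma> \<tau> = card {a \<in> {1..n}. \<sigma> a \<noteq> \<tau> a}"

definition k_commute :: "nat \<Rightarrow> nat \<Rightarrow> (nat \<Rightarrow> nat) \<Rightarrow> (nat \<Rightarrow> nat) \<Rightarrow> bool" where
  "k_commute n k \<alpha> \<beta> \<longleftrightarrow> hamming n (\<alpha> \<circ> \<beta>) (\<beta> \<circ> \<alpha>) = k"

definition num_k_commuting :: "nat \<Rightarrow> nat \<Rightarrow> (nat \<Rightarrow> nat) \<Rightarrow> nat" where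
  "num_k_commuting n k \<beta> = card {\<alpha> \<in> perms n. k_commute n k \<alpha> \<beta>}"

text \<open>
  The function \<open>cycle_of_list cs\<close>, for distinct \<open>cs\<close>, maps each entry of \<open>cs\<close> to the next one (cyclically) and fixes
  every other point, so the remaining \<open>n - m\<close> points of \<open>{1..n}\<close> are fixed.
\<close>
definition is_m_cycle :: "nat \<Rightarrow> nat \<Rightarrow> (nat \<Rightarrow> nat) \<Rightarrow> bool" where
  "is_m_cycle n m \<beta> \<longleftrightarrow>
     (\<exists>cs. cycle cs \<and> length cs = m \<and> set cs \<subseteq> {1..n} \<and> \<beta> = cycle_of_list cs)"

end

theory Submission
  imports Defs
begin

text \<open>
  Substituting \<open>b = \<alpha> a\<close> turns \<open>H(\<alpha>\<beta>, \<beta>\<alpha>)\<close> into \<open>H(\<alpha>\<beta>\<alpha>\<^sup>-\<^sup>1, \<beta>)\<close>. For \<open>\<beta>\<close> the cycle of the list \<open>c\<close>, the conjugate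
  \<open>\<alpha>\<beta>\<alpha>\<^sup>-\<^sup>1\<close> is the cycle of \<open>d = map \<alpha> c\<close>, and each injective \<open>d\<close> arises from \<open>(n - 4)!\<close> permutations.
  The distance between the two cycles depends only on the pattern of \<open>d\<close>, which records for each entry
  its position in \<open>c\<close>, or \<open>None\<close> if it lies outside \<open>c\<close>. A pattern with \<open>j\<close> entries \<open>None\<close> is realised by
  \<open>j! * ((n - 4) choose j)\<close> lists, and there are only \<open>209\<close> patterns of length \<open>4\<close>, which are enumerated.
\<close>

section \<open>Permutations with prescribed values on a list\<close>

text \<open>Follow the permutation obtained for the tails by the transposition of
  \<open>\<gamma> x\<close> and \<open>y\<close>. It leaves the entries of \<open>ys\<close> alone:
  they differ from \<open>\<gamma> x\<close> because \<open>\<gamma>\<close> is injective, and from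
  \<open>y\<close> because the target list is distinct.\<close>

lemma permutes_extending_lists_exists:
  assumes "distinct xs" "distinct ys" "length xs = length ys" "set xs \<subseteq> S" "set ys \<subseteq> S"
  shows "\<exists>\<gamma>. \<gamma> permutes S \<and> map \<gamma> xs = ys"
  using assms(3,1,2,4,5)
proof (induction xs ys rule: list_induct2)
  case Nil
  then show ?case by (auto intro: permutes_id)
next
  case (Cons x xs y ys)
  then obtain \<gamma> where \<gamma>: "\<gamma> permutes S" "map \<gamma> xs = ys" by auto
  define \<delta> where "\<delta> = transpose (\<gamma> x) y \<circ> \<gamma>"
  have "\<gamma> x \<in> S" using \<gamma>(1) Cons.prems by (simp add: permutes_in_image)
  then have "\<delta> permutes S"
    unfolding \<delta>_def using \<gamma>(1) Cons.prems by (auto intro: permutes_compose permutes_swap_id)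
  moreover have "\<delta> z = \<gamma> z" if "z \<in> set xs" for z
  proof -
    have "\<gamma> z \<noteq> \<gamma> x" using that Cons.prems(1) permutes_inj[OF \<gamma>(1)] by (auto dest: injD)
    moreover have "\<gamma> z \<noteq> y" using that Cons.prems(2) \<gamma>(2) by auto
    ultimately show ?thesis by (simp add: \<delta>_def transpose_def)
  qed
  then have "map \<delta> (x # xs) = y # ys" using \<gamma>(2) by (auto simp: \<delta>_def)
  ultimately show ?case by (intro exI[of _ \<delta>] conjI)
qed

text \<open>The solutions form a left coset: composing one solution \<open>\<gamma>\<close> with the
  permutations that fix \<open>xs\<close> pointwise, i.e. those of \<open>S - set xs\<close>, gives
  them all.\<close>

lemma card_permutes_extending_lists:
  assumes "finite S" "distinct xs" "distinct ys" "length xs = length ys" "set xs \<subseteq> S" "set ys \<subseteq> S"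
  shows "card {\<alpha>. \<alpha> permutes S \<and> map \<alpha> xs = ys} = fact (card S - length xs)"
proof -
  obtain \<gamma> where \<gamma>: "\<gamma> permutes S" "map \<gamma> xs = ys"
    using permutes_extending_lists_exists[OF assms(2-)] by blast
  have "bij_betw ((\<circ>) \<gamma>) {\<alpha>. \<alpha> permutes S - set xs} {\<alpha>. \<alpha> permutes S \<and> map \<alpha> xs = ys}"
  proof (rule bij_betw_byWitness[where f' = "(\<circ>) (inv \<gamma>)"])
    show "\<forall>\<alpha>\<in>{\<alpha>. \<alpha> permutes S - set xs}. inv \<gamma> \<circ> (\<gamma> \<circ> \<alpha>) = \<alpha>"
      using permutes_inv_o(2)[OF \<gamma>(1)] by (simp add: o_assoc)
    show "\<forall>\<alpha>\<in>{\<alpha>. \<alpha> permutes S \<and> map \<alpha> xs = ys}. \<gamma> \<circ> (inv \<gamma> \<circ> \<alpha>) = \<alpha>"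
      using permutes_inv_o(1)[OF \<gamma>(1)] by (simp add: o_assoc)
    show "(\<circ>) \<gamma> ` {\<alpha>. \<alpha> permutes S - set xs} \<subseteq> {\<alpha>. \<alpha> permutes S \<and> map \<alpha> xs = ys}"
    proof clarify
      fix \<alpha> assume \<alpha>: "\<alpha> permutes S - set xs"
      then have "\<alpha> permutes S" by (rule permutes_subset) auto
      moreover have "\<alpha> x = x" if "x \<in> set xs" for x
        using \<alpha> that by (auto simp: permutes_def)
      ultimately show "\<gamma> \<circ> \<alpha> permutes S \<and> map (\<gamma> \<circ> \<alpha>) xs = ys"
        using \<gamma> by (auto intro: permutes_compose)
    qed
    show "(\<circ>) (inv \<gamma>) ` {\<alpha>. \<alpha> permutes S \<and> map \<alpha> xs = ys} \<subseteq> {\<alpha>. \<alpha> permutes S - set xs}"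
    proof clarify
      fix \<alpha> assume \<alpha>: "\<alpha> permutes S" "ys = map \<alpha> xs"
      have "inv \<gamma> \<circ> \<alpha> permutes S"
        using \<alpha>(1) \<gamma>(1) by (auto intro: permutes_compose permutes_inv)
      moreover have "(inv \<gamma> \<circ> \<alpha>) x = x" if "x \<in> set xs" for x
        using \<gamma> \<alpha>(2) that by (auto simp: permutes_inv_eq[OF \<gamma>(1)])
      ultimately show "inv \<gamma> \<circ> \<alpha> permutes S - set xs"
        by (auto simp: permutes_def)
    qed
  qed
  from bij_betw_same_card[OF this]
  have "card {\<alpha>. \<alpha> permutes S \<and> map \<alpha> xs = ys} = card {\<alpha>. \<alpha> permutes S - set xs}" ..
  also have "\<dots> = fact (card S - length xs)"
    using assms by (intro card_permutations) (auto simp: card_Diff_subset distinct_card)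
  finally show ?thesis .
qed

section \<open>Lists with a given pattern\<close>

lemma card_distinct_lists_with_pattern:
  assumes "finite A" "finite B" "inj_on f A" "None \<notin> f ` A" "\<And>b. b \<in> B \<Longrightarrow> f b = None"
    and "distinct (filter (\<lambda>u. u \<noteq> None) p)" "set p \<subseteq> insert None (f ` A)"
  shows "card {d. distinct d \<and> set d \<subseteq> A \<union> B \<and> map f d = p} = fact (count_list p None) * (card B choose count_list p None)"
  using assms(2,5-)
proof (induction p arbitrary: B)
  case Nil
  have "{d. distinct d \<and> set d \<subseteq> A \<union> B \<and> map f d = []} = {[]}" by auto
  then show ?case by simp
next
  case (Cons u p)
  show ?case
  proof (cases u)
    case None
    let ?T = "\<lambda>b. {d. distinct d \<and> set d \<subseteq> A \<union> (B - {b}) \<and> map f d = p}"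
    have eq: "{d. distinct d \<and> set d \<subseteq> A \<union> B \<and> map f d = u # p} = (\<Union>b\<in>B. (#) b ` ?T b)" (is "?L = ?R")
    proof (intro set_eqI iffI)
      fix d assume d: "d \<in> ?L"
      then obtain b d' where [simp]: "d = b # d'" by (cases d) auto
      have "b \<notin> A" using d None assms(4) by force
      then show "d \<in> ?R" using d by (auto intro!: image_eqI)
    next
      fix d assume "d \<in> ?R"
      then show "d \<in> ?L" using None assms(4) Cons.prems(2) by force
    qed
    have card_T: "card ((#) b ` ?T b) = fact (count_list p None) * ((card B - 1) choose count_list p None)"
      and fin_T: "finite ((#) b ` ?T b)" if "b \<in> B" for b
    proof -
      have "card (?T b) = fact (count_list p None) * (card (B - {b}) choose count_list p None)"
        using Cons.prems None by (intro Cons.IH) auto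
      then show "card ((#) b ` ?T b) = fact (count_list p None) * ((card B - 1) choose count_list p None)"
        using that Cons.prems(1) by (simp add: card_image)
      have "?T b \<subseteq> {d. set d \<subseteq> A \<union> B \<and> length d = length p}" by auto
      then have "finite (?T b)"
        by (rule finite_subset) (use assms(1) Cons.prems(1) in \<open>simp add: finite_lists_length_eq\<close>)
      then show "finite ((#) b ` ?T b)" by simp
    qed
    have "card ?L = (\<Sum>b\<in>B. card ((#) b ` ?T b))"
      unfolding eq using Cons.prems(1) fin_T by (intro card_UN_disjoint) auto
    also have "\<dots> = card B * (fact (count_list p None) * ((card B - 1) choose count_list p None))"
      using card_T by simp
    also have "\<dots> = fact (count_list (u # p) None) * (card B choose count_list (u # p) None)"
    \<comment> \<open>For empty \<open>B\<close> both sides vanish, as the pattern contains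
      \<open>None\<close>; otherwise this is the absorption identity for binomial
      coefficients.\<close>
    proof (cases "card B")
      case (Suc k)
      let ?j = "count_list p None"
      have "Suc k * (fact ?j * (k choose ?j)) = fact ?j * (Suc ?j * (Suc k choose Suc ?j))"
        by (simp only: Suc_times_binomial mult.left_commute)
      also have "\<dots> = fact (Suc ?j) * (Suc k choose Suc ?j)"
        by (simp only: fact_Suc of_nat_id mult_ac)
      finally show ?thesis using Suc None by simp
    qed (simp add: None)
    finally show ?thesis .
  next
    case (Some i)
    then obtain a where a: "a \<in> A" "f a = Some i" using Cons.prems(4) by auto
    have "{d. distinct d \<and> set d \<subseteq> A \<union> B \<and> map f d = u # p}
      = (#) a ` {d. distinct d \<and> set d \<subseteq> A \<union> B \<and> map f d = p}" (is "?L = ?R")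
    proof (intro set_eqI iffI)
      fix d assume d: "d \<in> ?L"
      then obtain b d' where [simp]: "d = b # d'" by (cases d) auto
      have "b \<in> A" "f b = f a" using d a(2) Some Cons.prems(2) by auto
      then have "b = a" using a(1) inj_onD[OF assms(3)] by blast
      then show "d \<in> ?R" using d by auto
    next
      fix d assume "d \<in> ?R"
      then obtain e where e: "d = a # e" "distinct e" "set e \<subseteq> A \<union> B" "map f e = p" by auto
      \<comment> \<open>No label repeats in the pattern, so prepending \<open>a\<close> keeps the
        list distinct.\<close>
      have "Some i \<notin> set p" using Cons.prems(3) Some by simp
      then have "a \<notin> set e" using a(2) e(4) by (metis image_eqI set_map)
      then show "d \<in> ?L" using e a Some by simp
    qed
    moreover have "card {d. distinct d \<and> set d \<subseteq> A \<union> B \<and> map f d = p} = fact (count_list p None) * (card B choose count_list p None)"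
      using Cons.prems Some by (intro Cons.IH) auto
    ultimately show ?thesis using Some by (simp add: card_image)
  qed
qed

section \<open>Positions in a list and the action of its cycle\<close>

definition index_in :: "'a list \<Rightarrow> 'a \<Rightarrow> nat option" where
  "index_in c = map_of (zip c [0..<length c])"

lemma index_in_eq_None_iff [simp]: "index_in c x = None \<longleftrightarrow> x \<notin> set c"
  by (simp add: index_in_def)

lemma index_in_nth [simp]: "distinct c \<Longrightarrow> i < length c \<Longrightarrow> index_in c (c ! i) = Some i"
  unfolding index_in_def by (subst map_of_zip_nth) auto

lemma index_in_eq_Some_iff:
  "distinct c \<Longrightarrow> index_in c x = Some i \<longleftrightarrow> i < length c \<and> x = c ! i"
  by (metis index_in_nth index_in_eq_None_iff in_set_conv_nth option.distinct(1) option.inject)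

lemma inj_on_index_in: "distinct c \<Longrightarrow> inj_on (index_in c) (set c)"
  by (auto simp: inj_on_def in_set_conv_nth)

lemma index_in_image: "distinct c \<Longrightarrow> index_in c ` set c = Some ` {..<length c}"
  by (force simp: set_conv_nth)

lemma map_cycle_of_list: "distinct c \<Longrightarrow> map (cycle_of_list c) c = rotate1 c"
  using cyclic_rotation[of c 1] by simp

lemma cycle_of_list_nth:
  assumes "distinct c" "i < length c"
  shows "cycle_of_list c (c ! i) = c ! (Suc i mod length c)"
  using assms map_cycle_of_list[OF assms(1)] by (metis nth_map nth_rotate1)

lemma cycle_of_list_neq:
  assumes "distinct c" "length c \<ge> 2" "x \<in> set c"
  shows "cycle_of_list c x \<noteq> x"
proof -
  obtain i where i: "i < length c" "x = c ! i" using assms(3) by (auto simp: in_set_conv_nth)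
  \<comment> \<open>The last index wraps around to 0, which is a different index because the length
    is at least 2.\<close>
  have "Suc i mod length c \<noteq> i"
    using i(1) assms(2) by (cases "Suc i = length c") auto
  moreover have "Suc i mod length c < length c" using i(1) by (intro mod_less_divisor) auto
  ultimately show ?thesis
    using i assms(1) by (simp add: cycle_of_list_nth nth_eq_iff_index_eq)
qed

section \<open>The distance of two cycles, read off from the pattern\<close>

text \<open>The label form of "the cycle of \<open>c\<close> sends \<open>x\<close> to
  \<open>y\<close>" for distinct points. A point labelled \<open>None\<close> is fixed by that
  cycle, hence the value \<open>False\<close>.\<close>

definition successive :: "nat \<Rightarrow> nat option \<Rightarrow> nat option \<Rightarrow> bool" where
  "successive m u v = (case u of None \<Rightarrow> False | Some i \<Rightarrow> v = Some (Suc i mod m))"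

text \<open>
  Two cycles of lists \<open>c\<close> and \<open>d\<close> disagree on \<open>set c \<union> set d\<close> except at the entries of \<open>d\<close> which both send to
  the same point.
\<close>
definition pattern_distance :: "nat option list \<Rightarrow> nat" where
  "pattern_distance p = length p + count_list p None
     - length (filter (\<lambda>(u, v). successive (length p) u v) (zip p (rotate1 p)))"

lemma successive_index_in:
  assumes "distinct c" "x \<noteq> y"
  shows "successive (length c) (index_in c x) (index_in c y) \<longleftrightarrow> cycle_of_list c x = y"
proof (cases "x \<in> set c")
  case True
  then obtain i where i: "i < length c" "x = c ! i" by (auto simp: in_set_conv_nth)
  then have "Suc i mod length c < length c" by (intro mod_less_divisor) auto
  then show ?thesis
    using i assms by (auto simp: successive_def index_in_eq_Some_iff cycle_of_list_nth)
next
  case False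
  then have "index_in c x = None" by simp
  then have "\<not> successive (length c) (index_in c x) (index_in c y)"
    unfolding successive_def by (simp only: option.case not_False_eq_True)
  then show ?thesis using id_outside_supp[OF False] assms(2) by simp
qed

lemma hamming_cycles:
  assumes c: "distinct c" "set c \<subseteq> {1..n}" "length c \<ge> 2"
    and d: "distinct d" "set d \<subseteq> {1..n}" "length d = length c"
  shows "hamming n (cycle_of_list d) (cycle_of_list c) = pattern_distance (map (index_in c) d)"
proof -
  have moved: "cycle_of_list c x \<noteq> x" if "x \<in> set c" for x
    using that c by (intro cycle_of_list_neq)
  have moved': "cycle_of_list d x \<noteq> x" if "x \<in> set d" for x
    using that c d by (intro cycle_of_list_neq) auto
  let ?E = "{x \<in> set d. cycle_of_list d x = cycle_of_list c x}"
  \<comment> \<open>Outside both lists both cycles fix \<open>x\<close>; a point in exactly one list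
    is moved by exactly one of them. So agreement within the union needs a point of both
    lists.\<close>
  have "{a \<in> {1..n}. cycle_of_list d a \<noteq> cycle_of_list c a} = (set c \<union> set d) - ?E"
  proof (intro set_eqI)
    fix x
    show "x \<in> {a \<in> {1..n}. cycle_of_list d a \<noteq> cycle_of_list c a} \<longleftrightarrow> x \<in> (set c \<union> set d) - ?E"
      using c(2) d(2) moved[of x] id_outside_supp[of x c] id_outside_supp[of x d]
      by (cases "x \<in> set c"; cases "x \<in> set d") auto
  qed
  then have "hamming n (cycle_of_list d) (cycle_of_list c) = card (set c \<union> set d) - card ?E"
    unfolding hamming_def by (simp only:) (intro card_Diff_subset, auto)
  moreover have "card (set c \<union> set d) = length d + count_list (map (index_in c) d) None"
  proof -
    have "card (set c \<union> set d) = card (set c) + card (set d - set c)"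
      by (metis Diff_disjoint List.finite_set Un_Diff_cancel card_Un_disjoint finite_Diff)
    also have "set d - set c = set (filter (\<lambda>x. x \<notin> set c) d)" by auto
    also have "card \<dots> = length (filter (\<lambda>x. x \<notin> set c) d)"
      using d(1) by (intro distinct_card distinct_filter)
    finally show ?thesis
      using c(1) d(3) by (simp add: count_list_eq_length_filter filter_map distinct_card o_def eq_commute[of None])
  qed
  moreover have "card ?E = length (filter (\<lambda>(u, v). successive (length c) u v)
      (zip (map (index_in c) d) (rotate1 (map (index_in c) d))))"
  proof -
    have "card ?E = card (set (filter (\<lambda>x. cycle_of_list d x = cycle_of_list c x) d))"
      by (intro arg_cong[where f = card]) auto
    also have "\<dots> = length (filter (\<lambda>x. cycle_of_list d x = cycle_of_list c x) d)"
      using d(1) by (intro distinct_card distinct_filter)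
    also have "filter (\<lambda>x. cycle_of_list d x = cycle_of_list c x) d
      = filter (\<lambda>x. successive (length c) (index_in c x) (index_in c (cycle_of_list d x))) d"
      using successive_index_in[OF c(1) moved'[symmetric]] by (intro filter_cong) auto
    also have "length \<dots> = length (filter (\<lambda>(u, v). successive (length c) u v)
      (map (\<lambda>x. (index_in c x, index_in c (cycle_of_list d x))) d))"
      by (simp add: filter_map o_def)
    \<comment> \<open>The cycle of \<open>d\<close> sends each entry to the cyclically next one, so
      these pairs are the neighbours in the pattern.\<close>
    also have "map (\<lambda>x. (index_in c x, index_in c (cycle_of_list d x))) d
      = zip (map (index_in c) d) (rotate1 (map (index_in c) d))"
      unfolding rotate1_map map_cycle_of_list[OF d(1), symmetric]
      by (simp add: zip_map_map zip_same_conv_map o_def)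
    finally show ?thesis .
  qed
  ultimately show ?thesis using d(3) by (simp add: pattern_distance_def)
qed

lemma hamming_commutator:
  assumes "\<alpha> permutes {1..n}" "distinct c"
  shows "hamming n (\<alpha> \<circ> cycle_of_list c) (cycle_of_list c \<circ> \<alpha>)
    = hamming n (cycle_of_list (map \<alpha> c)) (cycle_of_list c)"
proof -
  have conj: "cycle_of_list (map \<alpha> c) (\<alpha> a) = \<alpha> (cycle_of_list c a)" for a
    using conjugation_of_cycle[OF assms(2) permutes_bij[OF assms(1)]]
    by (metis assms(1) comp_apply permutes_inverses(2))
  have "{a \<in> {1..n}. cycle_of_list (map \<alpha> c) a \<noteq> cycle_of_list c a}
    = \<alpha> ` {a \<in> {1..n}. (\<alpha> \<circ> cycle_of_list c) a \<noteq> (cycle_of_list c \<circ> \<alpha>) a}" (is "?L = \<alpha> ` ?R")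
  proof (intro set_eqI iffI)
    fix b assume b: "b \<in> ?L"
    then obtain a where "a \<in> {1..n}" "b = \<alpha> a" using permutes_image[OF assms(1)] by blast
    then show "b \<in> \<alpha> ` ?R" using b conj by auto
  next
    fix b assume "b \<in> \<alpha> ` ?R"
    then show "b \<in> ?L" using conj permutes_in_image[OF assms(1)] by fastforce
  qed
  then show ?thesis
    unfolding hamming_def using permutes_inj_on[OF assms(1)] by (simp add: card_image)
qed

section \<open>Summation over all patterns\<close>

text \<open>Only \<open>None\<close> may repeat, since different entries of \<open>d\<close> can
  both lie outside \<open>c\<close>. An explicit list, rather than a set, can be evaluated.\<close>

definition patterns :: "nat \<Rightarrow> nat option list list" where
  "patterns m = filter (\<lambda>p. distinct (filter (\<lambda>u. u \<noteq> None) p))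
     (List.n_lists m (None # map Some [0..<m]))"

lemma set_patterns:
  "set (patterns m) = {p. length p = m \<and> distinct (filter (\<lambda>u. u \<noteq> None) p)
     \<and> set p \<subseteq> insert None (Some ` {..<m})}"
  by (auto simp: patterns_def set_n_lists atLeast0LessThan)

lemma distinct_patterns: "distinct (patterns m)"
  unfolding patterns_def
  by (intro distinct_filter distinct_n_lists) (simp add: distinct_map)

lemma num_k_commuting_cycle:
  assumes c: "distinct c" "set c \<subseteq> {1..n}" "length c = m" "m \<ge> 2"
  shows "num_k_commuting n k (cycle_of_list c) = fact (n - m) *
    (\<Sum>p | p \<in> set (patterns m) \<and> pattern_distance p = k.
      fact (count_list p None) * ((n - m) choose count_list p None))"
proof -
  let ?D = "\<lambda>p. {d. distinct d \<and> set d \<subseteq> {1..n} \<and> map (index_in c) d = p}"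
  let ?A = "\<lambda>d. {\<alpha>. \<alpha> permutes {1..n} \<and> map \<alpha> c = d}"
  let ?P = "{p \<in> set (patterns m). pattern_distance p = k}"
  \<comment> \<open>The union is disjoint on both levels: \<open>\<alpha>\<close> determines
    \<open>d = map \<alpha> c\<close>, and \<open>d\<close> determines its pattern.\<close>
  have union: "{\<alpha> \<in> perms n. k_commute n k \<alpha> (cycle_of_list c)} = (\<Union>p\<in>?P. \<Union>d\<in>?D p. ?A d)"
  proof (intro set_eqI iffI)
    fix \<alpha> assume "\<alpha> \<in> {\<alpha> \<in> perms n. k_commute n k \<alpha> (cycle_of_list c)}"
    then have \<alpha>: "\<alpha> permutes {1..n}" and k: "hamming n (cycle_of_list (map \<alpha> c)) (cycle_of_list c) = k"
      using hamming_commutator c(1) by (auto simp: perms_def k_commute_def)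
    have d: "distinct (map \<alpha> c)" "set (map \<alpha> c) \<subseteq> {1..n}"
      using c permutes_inj_on[OF \<alpha>] permutes_in_image[OF \<alpha>] by (auto simp: distinct_map)
    have "distinct (map (index_in c) (filter (\<lambda>x. x \<in> set c) (map \<alpha> c)))"
      unfolding distinct_map[of "index_in c"]
      using d(1) by (intro conjI distinct_filter inj_on_subset[OF inj_on_index_in[OF c(1)]]) auto
    then have "distinct (filter (\<lambda>u. u \<noteq> None) (map (index_in c) (map \<alpha> c)))"
      by (simp add: filter_map o_def del: not_None_eq)
    moreover have "set (map (index_in c) (map \<alpha> c)) \<subseteq> insert None (Some ` {..<m})"
    proof -
      have "u \<in> insert None (Some ` {..<m})" if "u = index_in c x" for u x
        using that index_in_eq_Some_iff[OF c(1), of x] c(3) by (cases u) (auto dest: sym)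
      then show ?thesis by auto
    qed
    ultimately have "map (index_in c) (map \<alpha> c) \<in> ?P"
      using k c d by (simp add: set_patterns hamming_cycles)
    then show "\<alpha> \<in> (\<Union>p\<in>?P. \<Union>d\<in>?D p. ?A d)" using \<alpha> d by blast
  next
    fix \<alpha> assume "\<alpha> \<in> (\<Union>p\<in>?P. \<Union>d\<in>?D p. ?A d)"
    then have \<alpha>: "\<alpha> permutes {1..n}" "distinct (map \<alpha> c)" "set (map \<alpha> c) \<subseteq> {1..n}"
      "pattern_distance (map (index_in c) (map \<alpha> c)) = k" by auto
    then show "\<alpha> \<in> {\<alpha> \<in> perms n. k_commute n k \<alpha> (cycle_of_list c)}"
      using hamming_cycles[OF c(1,2) _ \<alpha>(2,3)] c
      by (simp add: perms_def k_commute_def hamming_commutator)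
  qed
  have fin_A: "finite (?A d)" for d
    by (rule finite_subset[OF _ finite_permutations[of "{1..n}"]]) auto
  have len: "length d = m" if "p \<in> ?P" "d \<in> ?D p" for p d
    using that by (auto simp: set_patterns)
  have fin_D: "finite (?D p)" for p
    by (rule finite_subset[OF _ finite_lists_length_eq[of "{1..n}" "length p"]]) auto
  have card_D: "card (?D p) = fact (count_list p None) * ((n - m) choose count_list p None)"
    if "p \<in> ?P" for p
  proof -
    \<comment> \<open>The labelled points are those of \<open>c\<close>; the other
      \<open>n - m\<close> points of \<open>{1..n}\<close> are unlabelled.\<close>
    have "card {d. distinct d \<and> set d \<subseteq> set c \<union> ({1..n} - set c) \<and> map (index_in c) d = p}
      = fact (count_list p None) * (card ({1..n} - set c) choose count_list p None)"
      using that c(1,3) inj_on_index_in[OF c(1)]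
      by (intro card_distinct_lists_with_pattern) (auto simp: set_patterns index_in_image)
    moreover have "card ({1..n} - set c) = n - m"
      using c by (simp add: card_Diff_subset distinct_card)
    moreover have "set c \<union> ({1..n} - set c) = {1..n}" using c(2) by auto
    ultimately show ?thesis by simp
  qed
  have "card (\<Union>d\<in>?D p. ?A d) = fact (n - m) * (fact (count_list p None) * ((n - m) choose count_list p None))"
    if "p \<in> ?P" for p
  proof -
    have "card (\<Union>d\<in>?D p. ?A d) = (\<Sum>d\<in>?D p. card (?A d))"
      using fin_A fin_D by (intro card_UN_disjoint) auto
    also have "\<dots> = (\<Sum>d\<in>?D p. fact (n - m))"
      using c len[OF that] card_permutes_extending_lists[of "{1..n}" c]
      by (intro sum.cong) auto
    finally show ?thesis using card_D[OF that] by simp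
  qed
  moreover have "card (\<Union>p\<in>?P. \<Union>d\<in>?D p. ?A d) = (\<Sum>p\<in>?P. card (\<Union>d\<in>?D p. ?A d))"
    using fin_A fin_D by (intro card_UN_disjoint) auto
  ultimately show ?thesis
    unfolding num_k_commuting_def union by (simp add: sum_distrib_left)
qed

section \<open>Evaluation for 4-cycles\<close>

text \<open>
  As an argument of \<open>tally\<close> the list of pattern statistics is normalised only once by \<open>code_simp\<close>, instead of
  once per counted entry.
\<close>
definition tally :: "'a list \<Rightarrow> 'a list list \<Rightarrow> nat list list" where
  "tally xs = map (map (count_list xs))"

text \<open>Rows are the distances 0, 3, ..., 8 and columns the numbers of entries
  \<open>None\<close>. The entries add up to 209, so every pattern is accounted for.\<close>

lemma tally_patterns:
  "tally (map (\<lambda>p. (pattern_distance p, count_list p None)) (patterns 4))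
     (map (\<lambda>k. map (Pair k) [0, 1, 2, 3, 4]) [0, 3, 4, 5, 6, 7, 8])
   = [[4, 0, 0, 0, 0], [16, 16, 0, 0, 0], [4, 32, 0, 0, 0], [0, 48, 16, 0, 0],
     [0, 0, 56, 0, 0], [0, 0, 0, 16, 0], [0, 0, 0, 0, 1]]"
  by code_simp

lemma num_k_commuting_4_cycle:
  assumes "distinct c" "set c \<subseteq> {1..n}" "length c = 4"
  shows "num_k_commuting n k (cycle_of_list c) = fact (n - 4) *
    (\<Sum>j<5. count_list (map (\<lambda>p. (pattern_distance p, count_list p None)) (patterns 4)) (k, j)
      * (fact j * ((n - 4) choose j)))"
proof -
  let ?P = "{p \<in> set (patterns 4). pattern_distance p = k}"
  let ?F = "\<lambda>j. fact j * ((n - 4) choose j)"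
  have fibre: "card {p \<in> ?P. count_list p None = j} =
      count_list (map (\<lambda>p. (pattern_distance p, count_list p None)) (patterns 4)) (k, j)" for j
  proof -
    have "{p \<in> ?P. count_list p None = j}
      = set (filter (\<lambda>p. (pattern_distance p, count_list p None) = (k, j)) (patterns 4))" by auto
    then show ?thesis
      by (simp only: distinct_card distinct_filter distinct_patterns)
        (simp add: count_list_eq_length_filter filter_map o_def eq_commute)
  qed
  have "count_list p None < 5" if "p \<in> set (patterns 4)" for p
    using that count_le_length[of p None] by (auto simp: set_patterns)
  \<comment> \<open>The summand depends on \<open>p\<close> only through its number of entries
    \<open>None\<close>, so patterns are grouped by that number, which is at most 4.\<close>
  then have "(\<Sum>p\<in>?P. ?F (count_list p None)) =
      (\<Sum>j<5. \<Sum>p | p \<in> ?P \<and> count_list p None = j. ?F (count_list p None))"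
    by (intro sum.group[symmetric]) auto
  also have "\<dots> = (\<Sum>j<5. card {p \<in> ?P. count_list p None = j} * ?F j)"
    by (intro sum.cong) auto
  finally show ?thesis using num_k_commuting_cycle[OF assms] unfolding fibre by simp
qed

theorem theorem3p4:
  fixes n :: nat and \<beta> :: "nat \<Rightarrow> nat"
  assumes "\<beta> \<in> perms n" and "is_m_cycle n 4 \<beta>"
  shows
    "(n \<ge> 4 \<longrightarrow> int (num_k_commuting n 0 \<beta>) = 4 * fact (n - 4)) \<and>
     (n \<ge> 4 \<longrightarrow> int (num_k_commuting n 3 \<beta>) = (4 * int n - 12) * (4 * fact (n - 4))) \<and>
     (n \<ge> 4 \<longrightarrow> int (num_k_commuting n 4 \<beta>) = (1 + 8 * (int n - 4)) * (4 * fact (n - 4))) \<and>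
     (n \<ge> 5 \<longrightarrow> int (num_k_commuting n 5 \<beta>) =
        (12 * (int n - 4) + 8 * int ((n - 4) choose 2)) * (4 * fact (n - 4))) \<and>
     (n \<ge> 6 \<longrightarrow> int (num_k_commuting n 6 \<beta>) =
        (14 * int n ^ 2 - 126 * int n + 280) * (4 * fact (n - 4))) \<and>
     (n \<ge> 7 \<longrightarrow> int (num_k_commuting n 7 \<beta>) =
        24 * int ((n - 4) choose 3) * (4 * fact (n - 4))) \<and>
     (n \<ge> 8 \<longrightarrow> int (num_k_commuting n 8 \<beta>) =
        6 * int ((n - 4) choose 4) * (4 * fact (n - 4))) \<and>
     (\<forall>k. 9 \<le> k \<and> k \<le> n \<longrightarrow> num_k_commuting n k \<beta> = 0)"
proof -
  from assms(2) obtain c where c: "distinct c" "set c \<subseteq> {1..n}" "length c = 4"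
    and \<beta>: "\<beta> = cycle_of_list c"
    unfolding is_m_cycle_def by blast
  have "card (set c) \<le> card {1..n}" using c(2) by (intro card_mono) auto
  \<comment> \<open>Four distinct points in \<open>{1..n}\<close> force \<open>n \<ge> 4\<close>;
    writing \<open>n = m + 4\<close> avoids truncated subtraction.\<close>
  then obtain m where n: "n = m + 4" using c(1,3) by (metis add.commute card_atLeastAtMost diff_Suc_1 distinct_card le_Suc_ex)
  let ?L = "map (\<lambda>p. (pattern_distance p, count_list p None)) (patterns 4)"
  have num: "num_k_commuting n k \<beta> = fact m * (\<Sum>j<5. count_list ?L (k, j) * (fact j * (m choose j)))" for k
    using num_k_commuting_4_cycle[OF c] unfolding \<beta> n by simp
  have choose2: "2 * int (m choose 2) = int m * (int m - 1)"
  proof -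
    have "2 * (m choose 2) = m * (m - 1)" using times_binomial_minus1_eq[of 2 m] by simp
    then have "2 * int (m choose 2) = int (m * (m - 1))" by linarith
    then show ?thesis by (cases m) (simp_all add: algebra_simps)
  qed
  note table = tally_patterns[unfolded tally_def list.map list.inject simp_thms One_nat_def]
  have F: "(\<Sum>j<5. g j) = g 0 + g 1 + g 2 + g 3 + g (4::nat)" for g :: "nat \<Rightarrow> nat"
    by (simp add: eval_nat_numeral)
  \<comment> \<open>The distance of a pattern is at most its length plus its number of entries
    \<open>None\<close>, hence at most 8.\<close>
  have zero: "num_k_commuting n k \<beta> = 0" if "k \<ge> 9" for k
  proof -
    have "pattern_distance p < k" if "p \<in> set (patterns 4)" for p
    proof -
      have "length p = 4" using that by (simp add: set_patterns)
      then show ?thesis using count_le_length[of p None] \<open>k \<ge> 9\<close> by (simp add: pattern_distance_def)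
    qed
    then have "(k, j) \<notin> set ?L" for j by auto
    then have "count_list ?L (k, j) = 0" for j by (simp only: count_list_0_iff not_False_eq_True)
    then show ?thesis unfolding num by simp
  qed
  have "int (num_k_commuting n 0 \<beta>) = 4 * fact m"
    unfolding num F by (simp add: table)
  moreover have "int (num_k_commuting n 3 \<beta>) = (4 * int n - 12) * (4 * fact m)"
    unfolding num F by (simp add: table n algebra_simps)
  moreover have "int (num_k_commuting n 4 \<beta>) = (1 + 8 * (int n - 4)) * (4 * fact m)"
    unfolding num F by (simp add: table n algebra_simps)
  moreover have "int (num_k_commuting n 5 \<beta>) = (12 * (int n - 4) + 8 * int (m choose 2)) * (4 * fact m)"
    unfolding num F by (simp add: table n algebra_simps)
  moreover have "int (num_k_commuting n 6 \<beta>) = (14 * int n ^ 2 - 126 * int n + 280) * (4 * fact m)"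
  proof -
    \<comment> \<open>Only patterns with two entries \<open>None\<close> contribute. With
      \<open>m = n - 4\<close> the count is \<open>56 * m * (m - 1) * m!\<close>, and
      \<open>14 * (n - 4) * (n - 5)\<close> expands to the stated quadratic.\<close>
    have "int (num_k_commuting n 6 \<beta>) = 56 * (2 * int (m choose 2)) * fact m"
      unfolding num F by (simp add: table)
    then show ?thesis unfolding choose2 n by (simp add: algebra_simps power2_eq_square)
  qed
  \<comment> \<open>The constants are \<open>16 * 3! = 24 * 4\<close> here and
    \<open>4! = 6 * 4\<close> for distance 8.\<close>
  moreover have "int (num_k_commuting n 7 \<beta>) = 24 * int (m choose 3) * (4 * fact m)"
    unfolding num F by (simp add: table fact_numeral)
  moreover have "int (num_k_commuting n 8 \<beta>) = 6 * int (m choose 4) * (4 * fact m)"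
    unfolding num F by (simp add: table fact_numeral)
  ultimately show ?thesis using zero n by simp
qed

end
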